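(* (a) Let $m\in\mathbb{N}$, let $A_1,A_2,\dots,A_m$ be (pairwise) disjoint infinite subsets of the set $P$ of primes and let $k_1,\dots,k_m,n_1,\dots,n_m\in\mathbb{N}$ be arbitrary. Then, for some prime ultrafilters $\mathcal{P}_1\in\overline{A_1},\mathcal{P}_2\in\overline{A_2},\dots,\mathcal{P}_m\in\overline{A_m}$, there is a $\leq_{fe}$-minimal ultrafilter $\mathcal{F}\in\beta\mathbb{N}$ such that $\mathcal{F}\supseteq F_{n_1,n_2,\dots,n_m}^{\mathcal{P}_1^{k_1},\mathcal{P}_2^{k_2},\dots,\mathcal{P}_m^{k_m}}$. (b) There is a $\leq_{fe}$-minimal ultrafilter in $\beta\mathbb{N}\setminus L$.
   Context: $\mathbb{N}$ is the set of positive integers, $P$ the set of primes, and $\beta\mathbb{N}$ the set of all ultrafilters on $\mathbb{N}$; each $n\in\mathbb{N}$ is identified with the principal ultrafilter $\{A\subseteq\mathbb{N}:n\in A\}$. For $A\subseteq\mathbb{N}$, $\overline{A}=\{\mathcal{F}\in\beta\mathbb{N}:A\in\mathcal{F}\}$. A prime ultrafilter is an element of $\overline{P}$. For $B_1,\dots,B_m\subseteq P$ and $k_i,n_i\in\mathbb{N}$ put $$(B_1^{k_1})^{(n_1)}\cdots(B_m^{k_m})^{(n_m)}=\Big\{\prod_{i=1}^m\prod_{j=1}^{n_i}a_{i,j}^{k_i}: a_{i,j}\in B_i\text{ for all }i,j,\text{ and all }a_{i,j}\text{ are distinct}\Big\}.$$ For prime ultrafilters $\mathcal{P}_1,\dots,\mathcal{P}_m$,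 $F_{n_1,\dots,n_m}^{\mathcal{P}_1^{k_1},\dots,\mathcal{P}_m^{k_m}}$ is the family of all sets $(B_1^{k_1})^{(n_1)}\cdots(B_m^{k_m})^{(n_m)}$ such that for all $i,j$: $B_i\in\mathcal{P}_i$, $B_i\subseteq P$, $B_i=B_j$ if $\mathcal{P}_i=\mathcal{P}_j$, and $B_i\cap B_j=\emptyset$ if $\mathcal{P}_i\neq\mathcal{P}_j$. For $n\in\mathbb{N}$, $L_n=\{p_1p_2\cdots p_n:p_1,\dots,p_n\in P\}$ is the set of numbers with exactly $n$ (not necessarily distinct) prime factors, and $L=\bigcup_{n\in\mathbb{N}}\overline{L_n}$. For $A,B\subseteq\mathbb{N}$, $A\leq_{fe}B$ means that for every finite $F\subseteq A$ there is $k\in\mathbb{N}$ with $kF=\{kf:f\in F\}\subseteq B$. For $\mathcal{F},\mathcal{G}\in\beta\mathbb{N}$, $\mathcal{F}\leq_{fe}\mathcal{G}$ means that for every $B\in\mathcal{G}$ there is $A\in\mathcal{F}$ with $A\leq_{fe}B$; $\mathcal{F}<_{fe}\mathcal{G}$ means $\mathcal{F}\leq_{fe}\mathcal{G}$ but not $\mathcal{G}\leq_{fe}\mathcal{F}$. When speaking of minimal elements, the (trivially smallest) element $1$ is excluded: $\mathcal{F}\in\beta\mathbb{N}\setminus\{1\}$ is $\leq_{fe}$-minimal if there is no $\mathcal{G}\in\beta\mathbb{N}\setminus\{1\}$ with $\mathcal{G}<_{fe}\mathcal{F}$. *)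

theory Defs
  imports "HOL-Computational_Algebra.Primes" "HOL-Library.Disjoint_Sets"
begin

text \<open>Since the type \<^typ>\<open>nat\<close> contains 0, the set of positive integers is carried explicitly;
  an ultrafilter on it is a family of subsets of it.\<close>

definition Npos :: "nat set" where
  "Npos = {n. 0 < n}"

definition primes :: "nat set" where
  "primes = {p. prime p}"

definition beta_N :: "nat set set set" where
  "beta_N = {\<F>. \<F> \<subseteq> Pow Npos \<and> Npos \<in> \<F> \<and> {} \<notin> \<F> \<and>
     (\<forall>A B. A \<in> \<F> \<and> A \<subseteq> B \<and> B \<subseteq> Npos \<longrightarrow> B \<in> \<F>) \<and>
     (\<forall>A B. A \<in> \<F> \<and> B \<in> \<F> \<longrightarrow> A \<inter> B \<in> \<F>) \<and>
     (\<forall>A. A \<subseteq> Npos \<longrightarrow> A \<in> \<F> \<or> Npos - A \<in> \<F>)}"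

definition principal_uf :: "nat \<Rightarrow> nat set set" where
  "principal_uf n = {A. A \<subseteq> Npos \<and> n \<in> A}"

definition uf_closure :: "nat set \<Rightarrow> nat set set set" where
  "uf_closure A = {\<F> \<in> beta_N. A \<in> \<F>}"

definition prime_ultrafilter :: "nat set set \<Rightarrow> bool" where
  "prime_ultrafilter \<P> \<longleftrightarrow> \<P> \<in> uf_closure primes"

text \<open>The set \<open>(B\<^sub>1^k\<^sub>1)\<^bsup>(n\<^sub>1)\<^esup> \<dots> (B\<^sub>m^k\<^sub>m)\<^bsup>(n\<^sub>m)\<^esup>\<close>. Tuples indexed by
  \<open>1, \<dots>, m\<close> are functions on \<^typ>\<open>nat\<close> whose values outside \<^term>\<open>{1..m}\<close> are
  irrelevant.\<close>

definition power_product_set ::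
  "nat \<Rightarrow> (nat \<Rightarrow> nat set) \<Rightarrow> (nat \<Rightarrow> nat) \<Rightarrow> (nat \<Rightarrow> nat) \<Rightarrow> nat set" where
  "power_product_set m B k n =
     {(\<Prod>i=1..m. \<Prod>j=1..n i. a i j ^ k i) | a :: nat \<Rightarrow> nat \<Rightarrow> nat.
        (\<forall>i\<in>{1..m}. \<forall>j\<in>{1..n i}. a i j \<in> B i) \<and>
        inj_on (\<lambda>(i, j). a i j) (SIGMA i:{1..m}. {1..n i})}"

text \<open>The family \<open>F\<close> with upper indices \<open>\<P>\<^sub>i^k\<^sub>i\<close> and lower indices \<open>n\<^sub>i\<close>.\<close>

definition pattern_family ::
  "nat \<Rightarrow> (nat \<Rightarrow> nat set set) \<Rightarrow> (nat \<Rightarrow> nat) \<Rightarrow> (nat \<Rightarrow> nat) \<Rightarrow> nat set set" where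
  "pattern_family m \<P> k n =
     {power_product_set m B k n | B :: nat \<Rightarrow> nat set.
        (\<forall>i\<in>{1..m}. B i \<in> \<P> i \<and> B i \<subseteq> primes) \<and>
        (\<forall>i\<in>{1..m}. \<forall>j\<in>{1..m}.
           (\<P> i = \<P> j \<longrightarrow> B i = B j) \<and> (\<P> i \<noteq> \<P> j \<longrightarrow> B i \<inter> B j = {}))}"

definition L_level :: "nat \<Rightarrow> nat set" where
  "L_level n = {(\<Prod>i=1..n. p i) | p :: nat \<Rightarrow> nat. \<forall>i\<in>{1..n}. p i \<in> primes}"

definition L_union :: "nat set set set" where
  "L_union = (\<Union>n\<in>Npos. uf_closure (L_level n))"

definition fe_le_set :: "nat set \<Rightarrow> nat set \<Rightarrow> bool" where
  "fe_le_set A B \<longleftrightarrow> (\<forall>F. finite F \<and> F \<subseteq> A \<longrightarrow> (\<exists>k\<in>Npos. (\<lambda>f. k * f) ` F \<subseteq> B))"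

definition fe_le :: "nat set set \<Rightarrow> nat set set \<Rightarrow> bool" where
  "fe_le \<F> \<G> \<longleftrightarrow> (\<forall>B\<in>\<G>. \<exists>A\<in>\<F>. fe_le_set A B)"

definition fe_less :: "nat set set \<Rightarrow> nat set set \<Rightarrow> bool" where
  "fe_less \<F> \<G> \<longleftrightarrow> fe_le \<F> \<G> \<and> \<not> fe_le \<G> \<F>"

definition fe_minimal :: "nat set set \<Rightarrow> bool" where
  "fe_minimal \<F> \<longleftrightarrow> \<F> \<in> beta_N - {principal_uf 1} \<and>
     \<not> (\<exists>\<G>\<in>beta_N - {principal_uf 1}. fe_less \<G> \<F>)"

end

theory Submission
  imports Defs "HOL-Library.Infinite_Set" "HOL-Library.Nat_Bijection"
begin

text \<open>Call a set \<open>S\<close> of positive integers divisor-sparse if every \<open>d > 1\<close> divides only finitely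
  many of its elements. The whole theorem rests on one observation
  (\<open>fe_minimal_if_divisor_sparse\<close>): every nonprincipal ultrafilter that contains a divisor-sparse
  set is minimal. Indeed, an embedding \<open>k * A \<subseteq> S\<close> of an infinite set \<open>A\<close> forces \<open>k = 1\<close>, so that
  a nonprincipal ultrafilter below the given one must be equal to it; and sparseness rules out
  the principal ultrafilters other than \<open>1\<close>.

  For part (b) the set of all \<open>p ^ p\<close> with \<open>p\<close> prime is divisor-sparse, and it meets every
  \<open>L_level n\<close> in at most one point; hence every nonprincipal ultrafilter containing it is as
  desired.

  For part (a) a divisor-sparse set of numbers of the prescribed shape is needed on which all
  the primes taken from \<open>A i\<close> can converge to the same ultrafilter \<open>\<P> i\<close>. Pairwise coprime
  numbers do not achieve this when \<open>n i \<ge> 2\<close>, because there the different prime factors would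
  run through disjoint sets. Instead, pairwise disjoint finite blocks are chosen inside each
  \<open>A i\<close>, the \<open>t\<close>-th of size \<open>t\<close>, and the numbers of the prescribed shape are formed with all primes
  taken from the \<open>t\<close>-th blocks for one common \<open>t\<close>. A prime lies in one block only and each
  block yields finitely many numbers, which gives sparseness. On the other hand, an ultrafilter
  \<open>U\<close> on the block positions all of whose members meet the blocks in unboundedly many points
  leaves room, inside each member, for as many distinct primes as the shape demands. The
  images of \<open>U\<close> in the sets \<open>A i\<close> are the prime ultrafilters \<open>\<P> i\<close>, and the required
  ultrafilter contains the numbers built from positions in \<open>C\<close>, for every \<open>C \<in> U\<close>.\<close>

section \<open>Ultrafilters avoiding an ideal\<close>

definition ultrafilters_on :: "'a set \<Rightarrow> 'a set set set" where
  "ultrafilters_on X = {\<F>. \<F> \<subseteq> Pow X \<and> X \<in> \<F> \<and> {} \<notin> \<F> \<and>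
     (\<forall>A B. A \<in> \<F> \<and> A \<subseteq> B \<and> B \<subseteq> X \<longrightarrow> B \<in> \<F>) \<and>
     (\<forall>A B. A \<in> \<F> \<and> B \<in> \<F> \<longrightarrow> A \<inter> B \<in> \<F>) \<and>
     (\<forall>A. A \<subseteq> X \<longrightarrow> A \<in> \<F> \<or> X - A \<in> \<F>)}"

lemma beta_N_eq: "beta_N = ultrafilters_on Npos"
  unfolding beta_N_def ultrafilters_on_def ..

lemma
  assumes "U \<in> ultrafilters_on X"
  shows ultrafilter_subset: "A \<in> U \<Longrightarrow> A \<subseteq> X"
    and ultrafilter_space: "X \<in> U"
    and ultrafilter_empty: "{} \<notin> U"
    and ultrafilter_mono: "A \<in> U \<Longrightarrow> A \<subseteq> B \<Longrightarrow> B \<subseteq> X \<Longrightarrow> B \<in> U"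
    and ultrafilter_Int: "A \<in> U \<Longrightarrow> B \<in> U \<Longrightarrow> A \<inter> B \<in> U"
    and ultrafilter_Diff: "A \<subseteq> X \<Longrightarrow> A \<notin> U \<Longrightarrow> X - A \<in> U"
proof -
  have sub: "U \<subseteq> Pow X" and X: "X \<in> U" and empty: "{} \<notin> U"
    and mono: "\<forall>A B. A \<in> U \<and> A \<subseteq> B \<and> B \<subseteq> X \<longrightarrow> B \<in> U"
    and Int: "\<forall>A B. A \<in> U \<and> B \<in> U \<longrightarrow> A \<inter> B \<in> U"
    and Diff: "\<forall>A. A \<subseteq> X \<longrightarrow> A \<in> U \<or> X - A \<in> U"
    using assms unfolding ultrafilters_on_def mem_Collect_eq by - (elim conjE, assumption)+
  show "A \<in> U \<Longrightarrow> A \<subseteq> X" using sub by blast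
  show "X \<in> U" by (rule X)
  show "{} \<notin> U" by (rule empty)
  show "A \<in> U \<Longrightarrow> A \<subseteq> B \<Longrightarrow> B \<subseteq> X \<Longrightarrow> B \<in> U" using mono by simp
  show "A \<in> U \<Longrightarrow> B \<in> U \<Longrightarrow> A \<inter> B \<in> U" using Int by simp
  show "A \<subseteq> X \<Longrightarrow> A \<notin> U \<Longrightarrow> X - A \<in> U" using Diff by blast
qed

lemma ultrafilters_onI:
  assumes "\<And>A. A \<in> U \<Longrightarrow> A \<subseteq> X" "X \<in> U" "{} \<notin> U"
    and "\<And>A B. A \<in> U \<Longrightarrow> A \<subseteq> B \<Longrightarrow> B \<subseteq> X \<Longrightarrow> B \<in> U"
    and "\<And>A B. A \<in> U \<Longrightarrow> B \<in> U \<Longrightarrow> A \<inter> B \<in> U"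
    and "\<And>A. A \<subseteq> X \<Longrightarrow> A \<notin> U \<Longrightarrow> X - A \<in> U"
  shows "U \<in> ultrafilters_on X"
proof -
  have "U \<subseteq> Pow X" using assms(1) by blast
  moreover have "\<forall>A B. A \<in> U \<and> A \<subseteq> B \<and> B \<subseteq> X \<longrightarrow> B \<in> U" using assms(4) by blast
  moreover have "\<forall>A B. A \<in> U \<and> B \<in> U \<longrightarrow> A \<inter> B \<in> U" using assms(5) by blast
  moreover have "\<forall>A. A \<subseteq> X \<longrightarrow> A \<in> U \<or> X - A \<in> U" using assms(6) by blast
  ultimately show ?thesis
    unfolding ultrafilters_on_def mem_Collect_eq using assms(2,3) by (intro conjI)
qed

lemma ultrafilter_INT:
  assumes U: "U \<in> ultrafilters_on X" and "finite J" and "\<And>i. i \<in> J \<Longrightarrow> C i \<in> U"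
  shows "X \<inter> (\<Inter>i\<in>J. C i) \<in> U"
  using assms(2,3)
proof (induction J rule: finite_induct)
  case empty
  then show ?case using ultrafilter_space[OF U] by simp
next
  case (insert i J)
  have "C i \<inter> (X \<inter> (\<Inter>i\<in>J. C i)) \<in> U"
    by (rule ultrafilter_Int[OF U]) (use insert in auto)
  then show ?case by (simp add: Int_left_commute)
qed

lemma ultrafilters_on_eqI:
  assumes "F \<in> ultrafilters_on X" "G \<in> ultrafilters_on X" "F \<subseteq> G"
  shows "F = G"
proof
  show "G \<subseteq> F"
  proof
    fix A assume A: "A \<in> G"
    show "A \<in> F"
    proof (rule ccontr)
      assume "A \<notin> F"
      then have "X - A \<in> G"
        using ultrafilter_Diff[OF assms(1)] ultrafilter_subset[OF assms(2) A] assms(3) by blast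
      then have "A \<inter> (X - A) \<in> G"
        using ultrafilter_Int[OF assms(2) A] by blast
      then show False using ultrafilter_empty[OF assms(2)] by simp
    qed
  qed
qed fact

text \<open>The prime ideal theorem for power sets, by Zorn's lemma: the complement of a maximal proper
  ideal is an ultrafilter.\<close>

lemma ultrafilter_avoiding_ideal:
  assumes "X \<notin> I" and "{} \<in> I"
    and down: "\<And>A B. B \<in> I \<Longrightarrow> A \<subseteq> B \<Longrightarrow> A \<in> I"
    and Un: "\<And>A B. A \<in> I \<Longrightarrow> B \<in> I \<Longrightarrow> A \<union> B \<in> I"
  obtains U where "U \<in> ultrafilters_on X" "U \<inter> I = {}"
proof -
  define K where "K = {J. I \<subseteq> J \<and> (\<forall>A B. B \<in> J \<and> A \<subseteq> B \<longrightarrow> A \<in> J) \<and>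
    (\<forall>A B. A \<in> J \<and> B \<in> J \<longrightarrow> A \<union> B \<in> J) \<and> X \<notin> J}"
  have KI: "J \<in> K" if "I \<subseteq> J" "X \<notin> J" "\<And>A B. B \<in> J \<Longrightarrow> A \<subseteq> B \<Longrightarrow> A \<in> J"
    "\<And>A B. A \<in> J \<Longrightarrow> B \<in> J \<Longrightarrow> A \<union> B \<in> J" for J
    unfolding K_def mem_Collect_eq
    by (intro conjI allI impI that(1,2)) (elim conjE, erule that(3,4), assumption)+
  have K_sub: "I \<subseteq> J" and K_space: "X \<notin> J" if "J \<in> K" for J
    using that unfolding K_def by simp_all
  have K_down: "A \<in> J" if "J \<in> K" "B \<in> J" "A \<subseteq> B" for J A B
    using that(1)[unfolded K_def mem_Collect_eq, THEN conjunct2, THEN conjunct1] that(2,3) by iprover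
  have K_Un: "A \<union> B \<in> J" if "J \<in> K" "A \<in> J" "B \<in> J" for J A B
    using that(1)[unfolded K_def mem_Collect_eq, THEN conjunct2, THEN conjunct2, THEN conjunct1]
      that(2,3) by simp
  have "I \<in> K" by (rule KI) (rule subset_refl assms(1) | (erule down Un, assumption))+
  have "\<exists>M\<in>K. \<forall>J\<in>K. M \<subseteq> J \<longrightarrow> J = M"
  proof (rule subset_Zorn_nonempty)
    show "K \<noteq> {}" using \<open>I \<in> K\<close> by auto
    fix C assume ne: "C \<noteq> {}" and chain: "subset.chain K C"
    have CK: "\<And>J. J \<in> C \<Longrightarrow> J \<in> K" and lin: "\<And>J J'. J \<in> C \<Longrightarrow> J' \<in> C \<Longrightarrow> J \<subseteq> J' \<or> J' \<subseteq> J"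
      using chain unfolding subset_chain_def by auto
    show "\<Union>C \<in> K"
    proof (rule KI)
      obtain J where "J \<in> C" using ne by auto
      then show "I \<subseteq> \<Union>C" using K_sub[OF CK] by auto
      show "X \<notin> \<Union>C" using K_space[OF CK] by auto
    next
      fix A B assume "B \<in> \<Union>C" "A \<subseteq> B"
      then obtain J where "J \<in> C" "A \<in> J" using K_down[OF CK] by (elim UnionE) iprover
      then show "A \<in> \<Union>C" by auto
    next
      fix A B assume "A \<in> \<Union>C" "B \<in> \<Union>C"
      then obtain J J' where J: "J \<in> C" "A \<in> J" "J' \<in> C" "B \<in> J'" by auto
      from lin[OF J(1,3)] obtain J'' where J'': "J'' \<in> C" "A \<in> J''" "B \<in> J''" using J by auto
      then have "A \<union> B \<in> J''" using K_Un[OF CK] by simp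
      then show "A \<union> B \<in> \<Union>C" using J''(1) by auto
    qed
  qed
  then obtain M where M: "M \<in> K" and max: "\<And>J. J \<in> K \<Longrightarrow> M \<subseteq> J \<Longrightarrow> J = M" by auto
  note IM = K_sub[OF M] and XM = K_space[OF M] and Mdown = K_down[OF M] and MUn = K_Un[OF M]
  have Mprime: "X - A \<in> M" if A: "A \<notin> M" for A
  proof -
    define J where "J = {Y. \<exists>Z\<in>M. Y \<subseteq> Z \<union> A}"
    have "{} \<in> M" using IM assms(2) by auto
    then have "A \<in> J" "M \<subseteq> J" unfolding J_def by auto
    have "X \<in> J"
    proof (rule ccontr)
      assume "X \<notin> J"
      have "J \<in> K"
      proof (rule KI)
        show "I \<subseteq> J" using \<open>M \<subseteq> J\<close> IM by simp
        show "X \<notin> J" by fact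
      next
        fix Y Y' assume Y: "Y' \<in> J" "Y \<subseteq> Y'"
        then obtain Z where Z: "Z \<in> M" "Y' \<subseteq> Z \<union> A" unfolding J_def by auto
        have "Y \<subseteq> Z \<union> A" using Y(2) Z(2) by (rule subset_trans)
        then show "Y \<in> J" using Z(1) unfolding J_def by auto
      next
        fix Y Y' assume "Y \<in> J" "Y' \<in> J"
        then obtain Z Z' where Z: "Z \<in> M" "Z' \<in> M" "Y \<subseteq> Z \<union> A" "Y' \<subseteq> Z' \<union> A"
          unfolding J_def by auto
        then have "Y \<union> Y' \<subseteq> (Z \<union> Z') \<union> A" by auto
        then show "Y \<union> Y' \<in> J" using MUn[OF Z(1,2)] unfolding J_def by auto
      qed
      then show False using max[OF _ \<open>M \<subseteq> J\<close>] A \<open>A \<in> J\<close> by simp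
    qed
    then obtain Z where "Z \<in> M" "X \<subseteq> Z \<union> A" unfolding J_def by auto
    then show ?thesis using Mdown[of Z "X - A"] by auto
  qed
  have MInt: "A \<inter> B \<notin> M" if "A \<subseteq> X" "B \<subseteq> X" "A \<notin> M" "B \<notin> M" for A B
  proof
    assume "A \<inter> B \<in> M"
    then have "(A \<inter> B) \<union> ((X - A) \<union> (X - B)) \<in> M" using that by (intro MUn Mprime)
    then show False using Mdown[of _ X] XM by blast
  qed
  have "{A. A \<subseteq> X \<and> A \<notin> M} \<in> ultrafilters_on X"
  proof (rule ultrafilters_onI, goal_cases)
    case (4 A B)
    then show ?case using Mdown[of B A] by blast
  next
    case (5 A B)
    then show ?case using MInt[of A B] by blast
  next
    case (6 A)
    then show ?case
      using MUn[of A "X - A"] Mdown[of "A \<union> (X - A)" X] XM by blast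
  qed (use XM IM assms(2) in auto)
  then show thesis by (rule that) (use IM in blast)
qed

lemma ultrafilter_mem_if_complement_in_ideal:
  assumes "U \<in> ultrafilters_on X" "U \<inter> I = {}" "A \<subseteq> X" "X - A \<in> I"
  shows "A \<in> U"
  using ultrafilter_Diff[OF assms(1,3)] assms(2,4) by auto

lemma ultrafilter_image:
  assumes U: "U \<in> ultrafilters_on X" and f: "f ` X \<subseteq> Y"
  shows "{B. B \<subseteq> Y \<and> {x \<in> X. f x \<in> B} \<in> U} \<in> ultrafilters_on Y"
proof (rule ultrafilters_onI)
  let ?V = "{B. B \<subseteq> Y \<and> {x \<in> X. f x \<in> B} \<in> U}"
  show "A \<subseteq> Y" if "A \<in> ?V" for A using that by blast
  have "{x \<in> X. f x \<in> Y} = X" using f by auto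
  then show "Y \<in> ?V" using ultrafilter_space[OF U] by simp
  show "{} \<notin> ?V" using ultrafilter_empty[OF U] by simp
  show "B \<in> ?V" if "A \<in> ?V" "A \<subseteq> B" "B \<subseteq> Y" for A B
  proof -
    have "{x \<in> X. f x \<in> A} \<subseteq> {x \<in> X. f x \<in> B}" using that(2) by blast
    then have "{x \<in> X. f x \<in> B} \<in> U" by (rule ultrafilter_mono[OF U, rotated]) (use that in auto)
    then show ?thesis using that(3) by simp
  qed
  show "A \<inter> B \<in> ?V" if "A \<in> ?V" "B \<in> ?V" for A B
  proof -
    have "{x \<in> X. f x \<in> A} \<inter> {x \<in> X. f x \<in> B} \<in> U"
      using that by (intro ultrafilter_Int[OF U]) auto
    moreover have "{x \<in> X. f x \<in> A} \<inter> {x \<in> X. f x \<in> B} = {x \<in> X. f x \<in> A \<inter> B}" by blast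
    ultimately show ?thesis using that by auto
  qed
  show "Y - A \<in> ?V" if "A \<subseteq> Y" "A \<notin> ?V" for A
  proof -
    have "X - {x \<in> X. f x \<in> A} \<in> U" using that by (intro ultrafilter_Diff[OF U]) auto
    moreover have "X - {x \<in> X. f x \<in> A} = {x \<in> X. f x \<in> Y - A}" using f by auto
    ultimately show ?thesis by auto
  qed
qed

lemma finite_mem_ultrafilter_singleton:
  assumes U: "U \<in> ultrafilters_on X" and "finite A" "A \<in> U"
  shows "\<exists>x\<in>A. {x} \<in> U"
proof (rule ccontr)
  assume no: "\<not> (\<exists>x\<in>A. {x} \<in> U)"
  have AX: "A \<subseteq> X" using ultrafilter_subset[OF U assms(3)] .
  have "X \<inter> (\<Inter>x\<in>A. X - {x}) \<in> U"
    using no AX by (intro ultrafilter_INT[OF U \<open>finite A\<close>] ultrafilter_Diff[OF U]) auto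
  then have "A \<inter> (X \<inter> (\<Inter>x\<in>A. X - {x})) \<in> U" by (intro ultrafilter_Int[OF U assms(3)])
  moreover have "A \<inter> (X \<inter> (\<Inter>x\<in>A. X - {x})) = {}" by blast
  ultimately show False using ultrafilter_empty[OF U] by simp
qed

lemma singleton_mem_beta_N_principal:
  assumes G: "G \<in> beta_N" and x: "{x} \<in> G"
  shows "G = principal_uf x"
proof
  have U: "G \<in> ultrafilters_on Npos" using G by (simp add: beta_N_eq)
  show "principal_uf x \<subseteq> G"
    using ultrafilter_mono[OF U x] unfolding principal_uf_def by blast
  show "G \<subseteq> principal_uf x"
  proof
    fix A assume A: "A \<in> G"
    have "A \<inter> {x} \<in> G" by (rule ultrafilter_Int[OF U A x])
    then have "x \<in> A" using ultrafilter_empty[OF U] by (cases "x \<in> A") auto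
    then show "A \<in> principal_uf x"
      using ultrafilter_subset[OF U A] unfolding principal_uf_def by simp
  qed
qed

section \<open>A sufficient condition for minimality\<close>

definition divisor_sparse :: "nat set \<Rightarrow> bool" where
  "divisor_sparse S \<longleftrightarrow> S \<subseteq> Npos \<and> (\<forall>d>1. finite {s \<in> S. d dvd s})"

lemma fe_le_refl: "fe_le F F"
proof -
  have "fe_le_set A A" for A
    unfolding fe_le_set_def by (intro allI impI bexI[of _ 1]) (auto simp: Npos_def)
  then show ?thesis unfolding fe_le_def by blast
qed

text \<open>A multiplier that works for a finite subset containing \<open>a\<close> is one of finitely many
  cofactors of \<open>a\<close> in \<open>B\<close>, so a single multiplier works for all finite subsets, and hence for all
  of \<open>A\<close>.\<close>

lemma fe_le_set_uniform_multiplier: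
  assumes AB: "fe_le_set A B" and a: "a \<in> A" "a > 0" and fin: "finite {b \<in> B. a dvd b}"
  obtains k where "k \<in> Npos" "(\<lambda>x. k * x) ` A \<subseteq> B"
proof -
  define K where "K = {k. k * a \<in> B}"
  have "finite ((\<lambda>k. k * a) ` K)" by (rule finite_subset[OF _ fin]) (auto simp: K_def)
  then have finK: "finite K" by (rule finite_imageD) (use a in \<open>auto simp: inj_on_def\<close>)
  show thesis
  proof (rule ccontr)
    assume "\<not> thesis"
    then have "\<forall>k\<in>Npos. \<exists>x\<in>A. k * x \<notin> B" using that by blast
    then obtain w where w: "\<And>k. k \<in> Npos \<Longrightarrow> w k \<in> A \<and> k * w k \<notin> B" by metis
    let ?F = "insert a (w ` (K \<inter> Npos))"
    have "finite ?F" "?F \<subseteq> A" using finK a w by auto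
    then obtain k where k: "k \<in> Npos" "(\<lambda>x. k * x) ` ?F \<subseteq> B"
      using AB unfolding fe_le_set_def by blast
    then have "k \<in> K" by (auto simp: K_def)
    then have "k * w k \<in> B" using k by blast
    then show False using w k(1) by blast
  qed
qed

text \<open>Let \<open>G\<close> lie below \<open>F\<close>. It is not principal: a number \<open>n > 1\<close> with \<open>{n} \<in> G\<close> would have
  multiples in every member of \<open>F\<close>, but \<open>F\<close> contains the elements of \<open>S\<close> that \<open>n\<close> does not
  divide. So the sets \<open>A \<in> G\<close> are infinite, and a multiplier \<open>k\<close> carrying \<open>A\<close> into \<open>B \<inter> S\<close> divides
  infinitely many elements of \<open>S\<close>. Hence \<open>k = 1\<close> and \<open>A \<subseteq> B\<close>, which shows \<open>F \<subseteq> G\<close>.\<close>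

lemma fe_minimal_if_divisor_sparse:
  assumes F: "F \<in> beta_N" and nonprincipal: "\<And>A. finite A \<Longrightarrow> A \<notin> F"
    and S: "S \<in> F" "divisor_sparse S"
  shows "fe_minimal F"
proof -
  have UF: "F \<in> ultrafilters_on Npos" using F by (simp add: beta_N_eq)
  have "F = G" if G: "G \<in> beta_N" "G \<noteq> principal_uf 1" and le: "fe_le G F" for G
  proof -
    have UG: "G \<in> ultrafilters_on Npos" using G by (simp add: beta_N_eq)
    have no_singleton: "{n} \<notin> G" for n
    proof
      assume n: "{n} \<in> G"
      then have "n \<noteq> 1" "n > 0"
        using singleton_mem_beta_N_principal[OF G(1)] G(2) ultrafilter_subset[OF UG n]
        by (auto simp: Npos_def)
      then have "finite {s \<in> S. n dvd s}" using S unfolding divisor_sparse_def by auto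
      then have "Npos - {s \<in> S. n dvd s} \<in> F"
        using nonprincipal S(2) by (intro ultrafilter_Diff[OF UF]) (auto simp: divisor_sparse_def)
      then have "S \<inter> (Npos - {s \<in> S. n dvd s}) \<in> F" by (intro ultrafilter_Int[OF UF] S)
      then obtain A where A: "A \<in> G" "fe_le_set A (S \<inter> (Npos - {s \<in> S. n dvd s}))"
        using le unfolding fe_le_def by blast
      have "n \<in> A"
        using singleton_mem_beta_N_principal[OF G(1) n] A(1) by (simp add: principal_uf_def)
      then have "\<exists>k\<in>Npos. (\<lambda>f. k * f) ` {n} \<subseteq> S \<inter> (Npos - {s \<in> S. n dvd s})"
        using A(2)[unfolded fe_le_set_def, rule_format, of "{n}"] by blast
      then show False by auto
    qed
    have infinite_mem: "infinite A" if "A \<in> G" for A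
      using finite_mem_ultrafilter_singleton[OF UG _ that] no_singleton by blast
    have "B \<in> G" if B: "B \<in> F" for B
    proof -
      have "B \<inter> S \<in> F" using ultrafilter_Int[OF UF B S(1)] .
      then obtain A where A: "A \<in> G" "fe_le_set A (B \<inter> S)"
        using le unfolding fe_le_def by blast
      have "\<not> A \<subseteq> {1}" using infinite_mem[OF A(1)] finite_subset by blast
      moreover have "A \<subseteq> Npos" using ultrafilter_subset[OF UG A(1)] .
      ultimately obtain a where a: "a \<in> A" "a > 1" by (force simp: Npos_def)
      have "finite {s \<in> S. a dvd s}" using S(2) a unfolding divisor_sparse_def by blast
      then have "finite {b \<in> B \<inter> S. a dvd b}" by (rule rev_finite_subset) blast
      then obtain k where k: "k \<in> Npos" "(\<lambda>x. k * x) ` A \<subseteq> B \<inter> S"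
        using fe_le_set_uniform_multiplier[OF A(2) a(1)] a(2) by auto
      have "k = 1"
      proof (rule ccontr)
        assume "k \<noteq> 1"
        then have "finite {s \<in> S. k dvd s}"
          using k(1) S(2) unfolding divisor_sparse_def by (auto simp: Npos_def)
        then have "finite ((\<lambda>x. k * x) ` A)" by (rule rev_finite_subset) (use k in auto)
        then have "finite A" by (rule finite_imageD) (use k in \<open>auto simp: inj_on_def Npos_def\<close>)
        then show False using infinite_mem A(1) by blast
      qed
      then have "A \<subseteq> B" using k by auto
      then show ?thesis using ultrafilter_mono[OF UG A(1)] ultrafilter_subset[OF UF B] by blast
    qed
    then show ?thesis using ultrafilters_on_eqI[OF UF UG] by blast
  qed
  then have "\<not> (\<exists>G\<in>beta_N - {principal_uf 1}. fe_less G F)"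
    using fe_le_refl unfolding fe_less_def by blast
  moreover have "F \<noteq> principal_uf 1"
    using nonprincipal[of "{1}"] by (auto simp: principal_uf_def Npos_def)
  ultimately show ?thesis using F unfolding fe_minimal_def by blast
qed

section \<open>A minimal ultrafilter outside \<open>L\<close>\<close>

lemma nonprincipal_ultrafilter_containing:
  assumes "infinite S" "S \<subseteq> Npos"
  obtains F where "F \<in> beta_N" "S \<in> F" "\<And>A. finite A \<Longrightarrow> A \<notin> F"
proof -
  let ?I = "{Y. finite (Y \<inter> S)}"
  obtain F where F: "F \<in> ultrafilters_on Npos" "F \<inter> ?I = {}"
  proof (rule ultrafilter_avoiding_ideal[of Npos ?I])
    show "Npos \<notin> ?I" using assms by (simp add: Int_absorb1)
    show "A \<in> ?I" if "B \<in> ?I" "A \<subseteq> B" for A B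
      using that by (auto intro: finite_subset[of "A \<inter> S" "B \<inter> S"])
  qed (auto simp: Int_Un_distrib2)
  have "S \<in> F"
    by (rule ultrafilter_mem_if_complement_in_ideal[OF F assms(2)]) (simp add: Int_commute)
  moreover have "A \<notin> F" if "finite A" for A using F(2) that by blast
  ultimately show thesis using that F(1) by (simp add: beta_N_eq)
qed

text \<open>The number \<open>p ^ p\<close> has exactly \<open>p\<close> prime factors, all equal to \<open>p\<close>.\<close>

lemma prime_self_power_mem_L_level:
  assumes "prime p" "p ^ p \<in> L_level n"
  shows "p = n"
proof -
  obtain q where q: "p ^ p = (\<Prod>i=1..n. q i)" "\<forall>i\<in>{1..n}. prime (q i)"
    using assms(2) unfolding L_level_def primes_def by auto
  have "q i = p" if i: "i \<in> {1..n}" for i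
  proof -
    have "q i dvd p ^ p" unfolding q(1) using i by (intro dvd_prodI) auto
    then have "q i dvd p" using q(2) i prime_dvd_power by blast
    then show ?thesis using assms(1) q(2) i primes_dvd_imp_eq by blast
  qed
  then have "p ^ p = p ^ n" using q(1) by simp
  then show ?thesis using prime_gt_1_nat[OF assms(1)] by simp
qed

lemma fe_minimal_outside_L: "\<exists>F\<in>beta_N - L_union. fe_minimal F"
proof -
  let ?S = "(\<lambda>p::nat. p ^ p) ` primes"
  have pos: "?S \<subseteq> Npos" by (auto simp: primes_def Npos_def prime_gt_0_nat)
  have dvd_eq: "p = q" if "prime p" "prime q" "q dvd p ^ p" for p q :: nat
    using that prime_dvd_power primes_dvd_imp_eq by blast
  have "inj_on (\<lambda>p::nat. p ^ p) primes"
  proof (rule inj_onI)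
    fix p q :: nat assume pq: "p \<in> primes" "q \<in> primes" "p ^ p = q ^ q"
    then have "q dvd p ^ p" by (simp add: primes_def prime_gt_0_nat dvd_power)
    then show "p = q" using dvd_eq pq by (simp add: primes_def)
  qed
  then have inf: "infinite ?S" using primes_infinite by (auto simp: primes_def dest: finite_imageD)
  have "divisor_sparse ?S"
    unfolding divisor_sparse_def
  proof (intro conjI allI impI pos)
    fix d :: nat assume "d > 1"
    then obtain q where q: "prime q" "q dvd d" using prime_factor_nat[of d] by auto
    have "{s \<in> ?S. d dvd s} \<subseteq> {q ^ q}"
      using dvd_eq[OF _ q(1)] dvd_trans[OF q(2)] by (auto simp: primes_def)
    then show "finite {s \<in> ?S. d dvd s}" using finite_subset by blast
  qed
  moreover obtain F where F: "F \<in> beta_N" "?S \<in> F" "\<And>A. finite A \<Longrightarrow> A \<notin> F"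
    using nonprincipal_ultrafilter_containing[OF inf pos] by blast
  ultimately have "fe_minimal F" using fe_minimal_if_divisor_sparse by blast
  moreover have "F \<notin> uf_closure (L_level n)" for n
  proof
    assume "F \<in> uf_closure (L_level n)"
    then have "?S \<inter> L_level n \<in> F"
      using F(1,2) unfolding uf_closure_def beta_N_eq by (auto intro: ultrafilter_Int)
    moreover have "?S \<inter> L_level n \<subseteq> {n ^ n}"
      using prime_self_power_mem_L_level by (auto simp: primes_def)
    then have "finite (?S \<inter> L_level n)" by (rule finite_subset) simp
    ultimately show False using F(3) by iprover
  qed
  ultimately show ?thesis using F(1) unfolding L_union_def by blast
qed

section \<open>Block positions and numbers of a prescribed shape\<close>

text \<open>Pairs with the same \<open>t\<close> form the \<open>t\<close>-th block. Blocks are finite for the sake of sparseness,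
  and of unbounded size to leave room for arbitrarily many distinct primes.\<close>

definition block_positions :: "(nat \<times> nat) set" where
  "block_positions = {(t, r). r < t}"

text \<open>The sets whose traces on the blocks have bounded size form an ideal, since the bounds add
  up in a union, and it is proper because the blocks themselves grow.\<close>

lemma ultrafilter_unbounded_on_blocks:
  obtains U where "U \<in> ultrafilters_on block_positions"
    and "\<And>C c. C \<in> U \<Longrightarrow> \<exists>t. card {r. (t, r) \<in> C} > c"
proof -
  let ?I = "{C. C \<subseteq> block_positions \<and> (\<exists>c. \<forall>t. card {r. (t, r) \<in> C} \<le> c)}"
  have fin: "finite {r. (t, r) \<in> C}" if "C \<subseteq> block_positions" for C t
    by (rule finite_subset[of _ "{..<t}"]) (use that in \<open>auto simp: block_positions_def\<close>)
  obtain U where U: "U \<in> ultrafilters_on block_positions" "U \<inter> ?I = {}"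
  proof (rule ultrafilter_avoiding_ideal[of block_positions ?I])
    show "block_positions \<notin> ?I"
    proof
      assume "block_positions \<in> ?I"
      then obtain c where "\<And>t. card {r. (t, r) \<in> block_positions} \<le> c" by blast
      from this[of "Suc c"] show False by (simp add: block_positions_def)
    qed
    show "A \<in> ?I" if B: "B \<in> ?I" "A \<subseteq> B" for A B
    proof -
      obtain c where c: "\<And>t. card {r. (t, r) \<in> B} \<le> c" using B by blast
      have "card {r. (t, r) \<in> A} \<le> c" for t
        using card_mono[OF fin[of B t], of "{r. (t, r) \<in> A}"] c[of t] B by fastforce
      then show ?thesis using B by blast
    qed
    show "A \<union> B \<in> ?I" if AB: "A \<in> ?I" "B \<in> ?I" for A B
    proof -
      obtain c d where c: "\<And>t. card {r. (t, r) \<in> A} \<le> c" and d: "\<And>t. card {r. (t, r) \<in> B} \<le> d"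
        using AB by blast
      have "card {r. (t, r) \<in> A \<union> B} \<le> c + d" for t
      proof -
        have "{r. (t, r) \<in> A \<union> B} = {r. (t, r) \<in> A} \<union> {r. (t, r) \<in> B}" by blast
        then show ?thesis
          using card_Un_le[of "{r. (t, r) \<in> A}" "{r. (t, r) \<in> B}"] c[of t] d[of t] by simp
      qed
      then show ?thesis using AB by blast
    qed
  qed auto
  have "\<exists>t. card {r. (t, r) \<in> C} > c" if C: "C \<in> U" for C c
  proof (rule ccontr)
    assume "\<not> ?thesis"
    then have "C \<in> ?I" using ultrafilter_subset[OF U(1) C] by (auto simp: not_less)
    then show False using U(2) C by blast
  qed
  then show thesis using that U(1) by blast
qed

text \<open>The prime \<open>a i x\<close> is the element of the \<open>i\<close>-th prime set at position \<open>x\<close>. All factors come from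
  one common block \<open>t\<close>, so that a prime can occur in finitely many products only. Distinctness
  is asked for each \<open>i\<close> separately because different \<open>i\<close> will draw on disjoint sets of primes.\<close>

definition block_products ::
  "nat \<Rightarrow> (nat \<Rightarrow> nat \<times> nat \<Rightarrow> nat) \<Rightarrow> (nat \<Rightarrow> nat) \<Rightarrow> (nat \<Rightarrow> nat) \<Rightarrow> (nat \<times> nat) set \<Rightarrow> nat set" where
  "block_products m a k n C =
     {(\<Prod>i=1..m. \<Prod>j=1..n i. a i (t, r i j) ^ k i) | t r.
        \<forall>i\<in>{1..m}. inj_on (r i) {1..n i} \<and> (\<forall>j\<in>{1..n i}. (t, r i j) \<in> C)}"

lemma block_products_mono:
  "C \<subseteq> D \<Longrightarrow> block_products m a k n C \<subseteq> block_products m a k n D"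
  unfolding block_products_def by blast

lemma block_products_pos:
  assumes "\<And>i x. i \<in> {1..m} \<Longrightarrow> prime (a i x)"
  shows "block_products m a k n C \<subseteq> Npos"
proof
  fix s assume "s \<in> block_products m a k n C"
  then obtain t r where "s = (\<Prod>i=1..m. \<Prod>j=1..n i. a i (t, r i j) ^ k i)"
    unfolding block_products_def by blast
  then show "s \<in> Npos"
    using assms by (auto simp: Npos_def prime_gt_0_nat intro!: prod_pos)
qed

text \<open>A prime factor of \<open>d\<close> determines the block of every product that it divides, and the
  products from one block are bounded.\<close>

lemma divisor_sparse_block_products:
  assumes prime: "\<And>i x. i \<in> {1..m} \<Longrightarrow> prime (a i x)"
    and inj: "\<And>i i' x x'. i \<in> {1..m} \<Longrightarrow> i' \<in> {1..m} \<Longrightarrow> a i x = a i' x' \<Longrightarrow> i = i' \<and> x = x'"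
  shows "divisor_sparse (block_products m a k n block_positions)"
  unfolding divisor_sparse_def
proof (intro conjI allI impI block_products_pos prime)
  fix d :: nat assume "d > 1"
  then obtain q where q: "prime q" "q dvd d" using prime_factor_nat[of d] by auto
  let ?S = "block_products m a k n block_positions"
  have factor: "\<exists>i\<in>{1..m}. \<exists>j. q = a i (t, r i j)"
    if dvd: "d dvd (\<Prod>i=1..m. \<Prod>j=1..n i. a i (t, r i j) ^ k i)" for t r
  proof -
    have "q dvd (\<Prod>i=1..m. \<Prod>j=1..n i. a i (t, r i j) ^ k i)" using q(2) dvd dvd_trans by blast
    then obtain i j where ij: "i \<in> {1..m}" "q dvd a i (t, r i j) ^ k i"
      using q(1) by (auto simp: prime_dvd_prod_iff)
    then have "q = a i (t, r i j)"
      using prime_dvd_power[OF q(1) ij(2)] primes_dvd_imp_eq[OF q(1) prime] by blast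
    then show ?thesis using ij by blast
  qed
  show "finite {s \<in> ?S. d dvd s}"
  proof (cases "\<exists>i\<in>{1..m}. \<exists>t r. q = a i (t, r)")
    case False
    have "\<not> d dvd s" if s: "s \<in> ?S" for s
    proof
      assume d: "d dvd s"
      obtain t r where "s = (\<Prod>i=1..m. \<Prod>j=1..n i. a i (t, r i j) ^ k i)"
        using s unfolding block_products_def by auto
      then show False using factor[of t r] d False by metis
    qed
    then have "{s \<in> ?S. d dvd s} = {}" by auto
    then show ?thesis by (simp only: finite.emptyI)
  next
    case True
    then obtain i0 t0 r0 where q0: "i0 \<in> {1..m}" "q = a i0 (t0, r0)" by blast
    define M where "M = Max ((\<lambda>(i, r). a i (t0, r)) ` ({1..m} \<times> {..<t0}))"
    have M: "a i (t0, r) \<le> M" if "i \<in> {1..m}" "r < t0" for i r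
      unfolding M_def by (rule Max_ge) (use that in force)+
    have "s \<le> (\<Prod>i=1..m. \<Prod>j=1..n i. M ^ k i)" if s: "s \<in> ?S" "d dvd s" for s
    proof -
      obtain t r where tr: "s = (\<Prod>i=1..m. \<Prod>j=1..n i. a i (t, r i j) ^ k i)"
        "\<forall>i\<in>{1..m}. \<forall>j\<in>{1..n i}. (t, r i j) \<in> block_positions"
        using s(1) unfolding block_products_def by blast
      have "t = t0" using factor[of t r] s(2) tr(1) q0 inj by blast
      show ?thesis unfolding tr(1) \<open>t = t0\<close> using tr(2)[unfolded \<open>t = t0\<close>]
        by (intro prod_mono conjI power_mono M) (auto simp: block_positions_def)
    qed
    then show ?thesis unfolding finite_nat_set_iff_bounded_le by blast
  qed
qed

text \<open>A block with sufficiently many points in \<open>C\<close> has room for the distinct positions that a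
  product needs. The products are arbitrarily large because a block with many points in \<open>C\<close>
  has a large index \<open>t\<close>, and the primes at positions of the \<open>t\<close>-th block are at least \<open>t\<close>.\<close>

lemma infinite_block_products:
  assumes "m \<ge> 1" and prime: "\<And>i x. i \<in> {1..m} \<Longrightarrow> prime (a i x)"
    and large: "\<And>i t r. i \<in> {1..m} \<Longrightarrow> t \<le> a i (t, r)"
    and kn: "\<And>i. i \<in> {1..m} \<Longrightarrow> k i \<ge> 1 \<and> n i \<ge> 1"
    and C: "C \<subseteq> block_positions" "\<And>c. \<exists>t. card {r. (t, r) \<in> C} > c"
  shows "infinite (block_products m a k n C)"
  unfolding infinite_nat_iff_unbounded_le
proof
  fix c
  (* The summand c makes t large; the sum of the n i leaves room for the injections r i below. *)
  obtain t where t: "card {r. (t, r) \<in> C} > c + (\<Sum>i=1..m. n i)" using C(2) by blast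
  have sub: "{r. (t, r) \<in> C} \<subseteq> {..<t}" using C(1) by (auto simp: block_positions_def)
  then have "card {r. (t, r) \<in> C} \<le> t" using card_mono[of "{..<t}"] by fastforce
  then have "c \<le> t" using t by simp
  have "\<exists>f. f ` {1..n i} \<subseteq> {r. (t, r) \<in> C} \<and> inj_on f {1..n i}" if i: "i \<in> {1..m}" for i
  proof (rule card_le_inj)
    show "finite {r. (t, r) \<in> C}" using sub finite_subset by blast
    have "n i \<le> (\<Sum>i=1..m. n i)" using i by (intro member_le_sum) auto
    then show "card {1..n i} \<le> card {r. (t, r) \<in> C}" using t by simp
  qed simp
  then obtain r where r: "\<And>i. i \<in> {1..m} \<Longrightarrow> r i ` {1..n i} \<subseteq> {r. (t, r) \<in> C} \<and> inj_on (r i) {1..n i}"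
    by metis
  define s where "s = (\<Prod>i=1..m. \<Prod>j=1..n i. a i (t, r i j) ^ k i)"
  have s: "s \<in> block_products m a k n C"
    unfolding block_products_def s_def mem_Collect_eq
  proof (intro exI[of _ t] exI[of _ r] conjI refl ballI)
    fix i assume i: "i \<in> {1..m}"
    show "inj_on (r i) {1..n i}" using r[OF i] by simp
    fix j assume "j \<in> {1..n i}"
    then have "r i j \<in> r i ` {1..n i}" by (rule imageI)
    then have "r i j \<in> {r. (t, r) \<in> C}" using r[OF i] by (elim conjE) (rule subsetD)
    then show "(t, r i j) \<in> C" by simp
  qed
  have one: "1 \<in> {1..m}" using assms(1) by simp
  have "a 1 (t, r 1 1) dvd a 1 (t, r 1 1) ^ k 1" using kn[OF one] by (simp add: dvd_power)
  also have "\<dots> dvd (\<Prod>j=1..n 1. a 1 (t, r 1 j) ^ k 1)"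
    using kn[OF one] by (intro dvd_prodI) auto
  also have "\<dots> dvd s" unfolding s_def using one by (intro dvd_prodI) auto
  finally have "a 1 (t, r 1 1) \<le> s"
    using subsetD[OF block_products_pos[of m a, OF prime] s]
    by (intro dvd_imp_le) (auto simp: Npos_def)
  then have "c \<le> s" using large[OF one, of t "r 1 1"] \<open>c \<le> t\<close> by linarith
  then show "\<exists>s\<ge>c. s \<in> block_products m a k n C" using s by blast
qed

section \<open>Minimal ultrafilters of a prescribed shape\<close>

text \<open>If \<open>B i \<in> \<P> i\<close> for all \<open>i\<close>, then the positions whose primes lie in all the \<open>B i\<close> at once form
  a member \<open>C\<close> of \<open>U\<close>, because the \<open>\<P> i\<close> are images of the same \<open>U\<close>. The products built from \<open>C\<close>
  belong to the pattern set of the \<open>B i\<close>, which is therefore a member of every ultrafilter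
  containing those products.\<close>

lemma fe_minimal_containing_pattern_family:
  assumes m: "m \<ge> 1" and A: "\<And>i. i \<in> {1..m} \<Longrightarrow> A i \<subseteq> primes \<and> infinite (A i)"
    and disj: "disjoint_family_on A {1..m}"
    and kn: "\<And>i. i \<in> {1..m} \<Longrightarrow> k i \<ge> 1 \<and> n i \<ge> 1"
  shows "\<exists>\<P>. (\<forall>i\<in>{1..m}. prime_ultrafilter (\<P> i) \<and> \<P> i \<in> uf_closure (A i)) \<and>
    (\<exists>\<F>. fe_minimal \<F> \<and> pattern_family m \<P> k n \<subseteq> \<F>)"
proof -
  (* Every position receives a prime of its own in each A i. The pairing function is used because
     it dominates its first component t, which makes the primes of the t-th block at least t. *)
  define a where "a i x = enumerate (A i) (prod_encode x)" for i x
  have aA: "a i x \<in> A i" if "i \<in> {1..m}" for i x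
    unfolding a_def using A[OF that] by (simp add: enumerate_in_set)
  have prime: "prime (a i x)" if "i \<in> {1..m}" for i x
    using aA[OF that, of x] A[OF that] by (auto simp: primes_def)
  have inj: "i = i' \<and> x = x'" if i: "i \<in> {1..m}" "i' \<in> {1..m}" and eq: "a i x = a i' x'"
    for i i' x x'
  proof -
    have "i = i'"
      using aA[OF i(1), of x] aA[OF i(2), of x'] eq disjoint_family_onD[OF disj i] by auto
    have inj_A: "inj (enumerate (A i))"
      using A[OF i(1)] by (simp add: strict_mono_enumerate strict_mono_imp_inj_on)
    have "enumerate (A i) (prod_encode x) = enumerate (A i) (prod_encode x')"
      using eq \<open>i = i'\<close> by (simp add: a_def)
    then have "prod_encode x = prod_encode x'" by (rule injD[OF inj_A])
    then show ?thesis using \<open>i = i'\<close> by simp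
  qed
  have large: "t \<le> a i (t, r)" if "i \<in> {1..m}" for i t r
  proof -
    have "t \<le> prod_encode (t, r)" by (rule le_prod_encode_1)
    also have "\<dots> \<le> a i (t, r)" unfolding a_def using A[OF that] by (simp add: le_enumerate)
    finally show ?thesis .
  qed
  obtain U where U: "U \<in> ultrafilters_on block_positions"
    and unb: "\<And>C c. C \<in> U \<Longrightarrow> \<exists>t. card {r. (t, r) \<in> C} > c"
    using ultrafilter_unbounded_on_blocks by blast
  define \<P> where "\<P> i = {B. B \<subseteq> Npos \<and> {x \<in> block_positions. a i x \<in> B} \<in> U}" for i
  have P: "\<P> i \<in> beta_N" "A i \<in> \<P> i" "primes \<in> \<P> i" if i: "i \<in> {1..m}" for i
  proof -
    show "\<P> i \<in> beta_N" unfolding \<P>_def beta_N_eq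
      by (rule ultrafilter_image[OF U]) (use prime[OF i] in \<open>auto simp: Npos_def prime_gt_0_nat\<close>)
    have "{x \<in> block_positions. a i x \<in> A i} = block_positions"
      "{x \<in> block_positions. a i x \<in> primes} = block_positions"
      using aA[OF i] A[OF i] by auto
    moreover have "primes \<subseteq> Npos" by (auto simp: primes_def Npos_def prime_gt_0_nat)
    ultimately show "A i \<in> \<P> i" "primes \<in> \<P> i"
      using ultrafilter_space[OF U] A[OF i] unfolding \<P>_def by auto
  qed
  let ?T = "block_products m a k n"
  have infT: "infinite (?T C)" if "C \<in> U" for C
    using infinite_block_products[of m a k n C] m prime large kn ultrafilter_subset[OF U that]
      unb[OF that] by blast
  (* The ideal dual to the filter generated by the sets ?T C and the cofinite sets. *)
  define I where "I = {Y. \<exists>C\<in>U. finite (Y \<inter> ?T C)}"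
  obtain F where F: "F \<in> ultrafilters_on Npos" "F \<inter> I = {}"
  proof (rule ultrafilter_avoiding_ideal[of Npos I])
    show "Npos \<notin> I"
      using infT block_products_pos[of m a, OF prime] unfolding I_def by (auto simp: Int_absorb1)
    show "{} \<in> I" using ultrafilter_space[OF U] unfolding I_def by auto
    show "Y \<in> I" if Z: "Z \<in> I" "Y \<subseteq> Z" for Y Z
    proof -
      obtain C where C: "C \<in> U" "finite (Z \<inter> ?T C)" using Z unfolding I_def by blast
      have "Y \<inter> ?T C \<subseteq> Z \<inter> ?T C" using Z(2) by (rule Int_mono) simp
      then have "finite (Y \<inter> ?T C)" using C(2) by (rule finite_subset)
      then show ?thesis using C(1) unfolding I_def by auto
    qed
    show "Y \<union> Z \<in> I" if YZ: "Y \<in> I" "Z \<in> I" for Y Z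
    proof -
      obtain C D where C: "C \<in> U" "finite (Y \<inter> ?T C)" and D: "D \<in> U" "finite (Z \<inter> ?T D)"
        using YZ unfolding I_def by blast
      have "?T (C \<inter> D) \<subseteq> ?T C" "?T (C \<inter> D) \<subseteq> ?T D" by (simp_all add: block_products_mono)
      then have "(Y \<union> Z) \<inter> ?T (C \<inter> D) \<subseteq> (Y \<inter> ?T C) \<union> (Z \<inter> ?T D)" by blast
      then have "finite ((Y \<union> Z) \<inter> ?T (C \<inter> D))"
        by (rule finite_subset) (use C(2) D(2) in simp)
      then show ?thesis using ultrafilter_Int[OF U C(1) D(1)] unfolding I_def by auto
    qed
  qed
  have TF: "?T C \<in> F" if "C \<in> U" for C
  proof (rule ultrafilter_mem_if_complement_in_ideal[OF F])
    show "?T C \<subseteq> Npos" by (rule block_products_pos[of m a, OF prime])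
    have "(Npos - ?T C) \<inter> ?T C = {}" by blast
    then have "finite ((Npos - ?T C) \<inter> ?T C)" by (simp only: finite.emptyI)
    then show "Npos - ?T C \<in> I" unfolding I_def mem_Collect_eq using that by (rule bexI)
  qed
  have "fe_minimal F"
  proof (rule fe_minimal_if_divisor_sparse)
    show "F \<in> beta_N" using F(1) by (simp add: beta_N_eq)
    show "Y \<notin> F" if "finite Y" for Y
    proof -
      have "Y \<in> I" unfolding I_def mem_Collect_eq
        by (rule bexI[OF _ ultrafilter_space[OF U]]) (use that in simp)
      then show ?thesis using F(2) by auto
    qed
    show "?T block_positions \<in> F" by (rule TF[OF ultrafilter_space[OF U]])
    show "divisor_sparse (?T block_positions)"
      by (rule divisor_sparse_block_products[of m a, OF prime inj])
  qed
  moreover have "pattern_family m \<P> k n \<subseteq> F"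
  proof
    fix Y assume "Y \<in> pattern_family m \<P> k n"
    then obtain B where Y: "Y = power_product_set m B k n"
      and B: "\<And>i. i \<in> {1..m} \<Longrightarrow> B i \<in> \<P> i \<and> B i \<subseteq> primes"
      unfolding pattern_family_def by blast
    define C where "C = block_positions \<inter> (\<Inter>i\<in>{1..m}. {x \<in> block_positions. a i x \<in> B i})"
    have "C \<in> U" unfolding C_def
      by (rule ultrafilter_INT[OF U]) (use B in \<open>auto simp: \<P>_def\<close>)
    moreover have "?T C \<subseteq> Y"
    proof
      fix s assume "s \<in> ?T C"
      then obtain t r where s: "s = (\<Prod>i=1..m. \<Prod>j=1..n i. a i (t, r i j) ^ k i)"
        and r: "\<And>i. i \<in> {1..m} \<Longrightarrow> inj_on (r i) {1..n i} \<and> (\<forall>j\<in>{1..n i}. (t, r i j) \<in> C)"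
        unfolding block_products_def by blast
      have "\<forall>i\<in>{1..m}. \<forall>j\<in>{1..n i}. a i (t, r i j) \<in> B i" using r unfolding C_def by fast
      moreover have "inj_on (\<lambda>(i, j). a i (t, r i j)) (SIGMA i:{1..m}. {1..n i})"
      proof (rule inj_onI, clarify)
        fix i j i' j'
        assume i: "i \<in> {1..m}" "i' \<in> {1..m}" and j: "j \<in> {1..n i}" "j' \<in> {1..n i'}"
          and eq: "a i (t, r i j) = a i' (t, r i' j')"
        have "i = i'" "r i j = r i' j'" using inj[OF i eq] by auto
        then have "j = j'" using inj_onD[of "r i" "{1..n i}" j j'] r[OF i(1)] j by simp
        with \<open>i = i'\<close> show "i = i' \<and> j = j'" by (rule conjI)
      qed
      ultimately show "s \<in> Y" unfolding Y s power_product_set_def mem_Collect_eq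
        by (intro exI[of _ "\<lambda>i j. a i (t, r i j)"] conjI refl)
    qed
    moreover have "Y \<subseteq> Npos"
    proof
      fix s assume "s \<in> Y"
      then obtain b where s: "s = (\<Prod>i=1..m. \<Prod>j=1..n i. b i j ^ k i)"
        and b: "\<forall>i\<in>{1..m}. \<forall>j\<in>{1..n i}. b i j \<in> B i"
        unfolding Y power_product_set_def by blast
      have "b i j > 0" if ij: "i \<in> {1..m}" "j \<in> {1..n i}" for i j
      proof -
        have "b i j \<in> B i" using b ij by simp
        then have "prime (b i j)" using B[OF ij(1)] by (auto simp: primes_def)
        then show ?thesis by (rule prime_gt_0_nat)
      qed
      then show "s \<in> Npos" unfolding s Npos_def by (auto intro!: prod_pos)
    qed
    ultimately show "Y \<in> F" using TF ultrafilter_mono[OF F(1)] by blast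
  qed
  ultimately show ?thesis
    using P unfolding prime_ultrafilter_def uf_closure_def by (intro exI[of _ \<P>]) blast
qed

theorem theorem3p6:
  shows "(\<forall>(m::nat) (A :: nat \<Rightarrow> nat set) (k :: nat \<Rightarrow> nat) (n :: nat \<Rightarrow> nat).
            m \<ge> 1 \<and>
            (\<forall>i\<in>{1..m}. A i \<subseteq> primes \<and> infinite (A i)) \<and>
            disjoint_family_on A {1..m} \<and>
            (\<forall>i\<in>{1..m}. k i \<ge> 1 \<and> n i \<ge> 1) \<longrightarrow>
            (\<exists>\<P> :: nat \<Rightarrow> nat set set.
               (\<forall>i\<in>{1..m}. prime_ultrafilter (\<P> i) \<and> \<P> i \<in> uf_closure (A i)) \<and>
               (\<exists>\<F>. fe_minimal \<F> \<and> pattern_family m \<P> k n \<subseteq> \<F>)))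
         \<and> (\<exists>\<F> \<in> beta_N - L_union. fe_minimal \<F>)"
  using fe_minimal_containing_pattern_family fe_minimal_outside_L by simp

end
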